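(* Let $p:\mathbb{R}^n\to\mathbb{R}$ be a cubic polynomial written in the form $$p(x)=\frac{1}{6}\sum_{i=1}^n x^Tx_iH_ix+\frac{1}{2}x^TQx+b^Tx,$$ where $b\in\mathbb{R}^n$ and $H_1,\ldots,H_n,Q$ are real symmetric $n\times n$ matrices with $(H_i)_{jk}=(H_j)_{ik}=(H_k)_{ij}$ for all $i,j,k\in\{1,\ldots,n\}$. Then the set of second-order points of $p$ is equal to the set of all $y\in\mathbb{R}^n$ for which there exist a real symmetric $n\times n$ matrix $Y$ and $z\in\mathbb{R}$ such that $$\frac{1}{2}\mathrm{Tr}(QY)+b^Ty+\frac{z}{2}=0,\qquad \frac{1}{2}\mathrm{Tr}(H_iY)+e_i^TQy+b_i=0\ \ \forall i=1,\ldots,n,$$ $$T(Y,y,z)\succeq 0,\qquad \begin{bmatrix} Y & y\\ y^T & 1\end{bmatrix}\succeq 0,$$ where $$T(Y,y,z)=\begin{bmatrix} \sum_{i=1}^n y_iH_i+Q & \sum_{i=1}^n \mathrm{Tr}(H_iY)e_i+Qy\\ \left(\sum_{i=1}^n \mathrm{Tr}(H_iY)e_i+Qy\right)^T & z\end{bmatrix}.$$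
   Context: A cubic polynomial is a real polynomial all of whose monomials have degree at most 3 (the constant term is taken to be 0; every such polynomial can be written in the displayed form). A second-order point of $p$ is a point $x$ with $\nabla p(x)=0$ and $\nabla^2 p(x)\succeq 0$. $e_i$ is the $i$-th coordinate vector of $\mathbb{R}^n$, $\mathrm{Tr}$ is the trace, and $M\succeq 0$ means $M$ is positive semidefinite. *)

theory Defs
  imports "HOL-Analysis.Analysis"
begin

definition symmetric_matrix :: "real^'n^'n \<Rightarrow> bool" where
  "symmetric_matrix A \<longleftrightarrow> transpose A = A"

definition psd :: "real^'n^'n \<Rightarrow> bool" where
  "psd A \<longleftrightarrow> symmetric_matrix A \<and> (\<forall>x. 0 \<le> x \<bullet> (A *v x))"

(* Both operators are total: gradient is unspecified at points where the function is not
   differentiable, hessian where its gradient is not.  They are meant for smooth functions. *)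
definition gradient :: "(real^'n \<Rightarrow> real) \<Rightarrow> real^'n \<Rightarrow> real^'n" where
  "gradient f x = (THE D. GDERIV f x :> D)"

definition hessian :: "(real^'n \<Rightarrow> real) \<Rightarrow> real^'n \<Rightarrow> real^'n^'n" where
  "hessian f x = jacobian (gradient f) (at x)"

definition second_order_point :: "(real^'n \<Rightarrow> real) \<Rightarrow> real^'n \<Rightarrow> bool" where
  "second_order_point f x \<longleftrightarrow> gradient f x = 0 \<and> psd (hessian f x)"

(* The (n+1) x (n+1) block matrix with rows [A, v] and [v^T, c]; the index type
   'n option supplies the extra last row and column as None. *)
definition bordered_matrix :: "real^'n^'n \<Rightarrow> real^'n \<Rightarrow> real \<Rightarrow> real^('n option)^('n option)" where
  "bordered_matrix A v c = (\<chi> i j.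
     case i of
       Some k \<Rightarrow> (case j of Some l \<Rightarrow> A $ k $ l | None \<Rightarrow> v $ k)
     | None \<Rightarrow> (case j of Some l \<Rightarrow> v $ l | None \<Rightarrow> c))"

definition T_matrix ::
  "('n \<Rightarrow> real^'n^'n) \<Rightarrow> real^'n^'n \<Rightarrow> real^'n^'n \<Rightarrow> real^'n \<Rightarrow> real \<Rightarrow> real^('n option)^('n option)"
where
  "T_matrix H Q Y y z =
     bordered_matrix ((\<Sum>i\<in>UNIV. (y $ i) *\<^sub>R H i) + Q)
       ((\<Sum>i\<in>UNIV. trace (H i ** Y) *\<^sub>R axis i 1) + Q *v y) z"

end

theory Submission
  imports Defs
begin

text \<open>With \<open>M y = \<Sum>\<^sub>i y\<^sub>i H\<^sub>i + Q\<close>, the Hessian of \<open>p\<close> at \<open>y\<close>, the symmetry of the \<open>H\<^sub>i\<close> gives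
  \<open>\<nabla>p(y)\<^sub>i = y\<^sup>T H\<^sub>i y / 2 + (Q y)\<^sub>i + b\<^sub>i\<close>. A second-order point yields the feasible \<open>Y = y y\<^sup>T\<close>,
  \<open>z = y\<^sup>T M y\<close>. Conversely, for feasible \<open>(Y, y, z)\<close> the linear constraints imply
  \<open>Tr (M (Y - y y\<^sup>T)) + (y, -1)\<^sup>T T (y, -1) = 0\<close>. Both terms are nonnegative, so the second vanishes and
  \<open>(y, -1)\<close> lies in the kernel of \<open>T\<close>. Its top block reads \<open>Tr (H\<^sub>i Y) = y\<^sup>T H\<^sub>i y\<close>, which turns the
  constraint into \<open>\<nabla>p(y) = 0\<close>.\<close>

section \<open>Symmetric matrices and kernels of semidefinite forms\<close>

lemma symmetric_matrix_nth: "symmetric_matrix A \<Longrightarrow> A $ i $ j = A $ j $ i"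
  by (auto simp: symmetric_matrix_def transpose_def vec_eq_iff)

lemma symmetric_matrixI: "(\<And>i j. A $ i $ j = A $ j $ i) \<Longrightarrow> symmetric_matrix A"
  unfolding symmetric_matrix_def transpose_def by (simp add: vec_eq_iff)

lemma symmetric_matrix_inner_commute:
  "symmetric_matrix A \<Longrightarrow> x \<bullet> (A *v y) = y \<bullet> (A *v x)"
  unfolding symmetric_matrix_def
  by (metis dot_lmul_matrix inner_commute transpose_matrix_vector)

lemma symmetric_matrix_quadratic_add:
  assumes "symmetric_matrix A"
  shows "(x + t *\<^sub>R y) \<bullet> (A *v (x + t *\<^sub>R y))
    = x \<bullet> (A *v x) + 2 * t * (y \<bullet> (A *v x)) + t\<^sup>2 * (y \<bullet> (A *v y))"
  using symmetric_matrix_inner_commute[OF assms, of x y]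
  by (simp add: matrix_vector_right_distrib matrix_vector_mult_scaleR inner_add_left inner_add_right
      algebra_simps power2_eq_square)

text \<open>With \<open>w = A *v x\<close>, moving from \<open>x\<close> to
  \<open>x + t *\<^sub>R w\<close> changes the form from 0 by 2t|w|^2 + O(t^2), which is negative
  for small negative \<open>t\<close> unless \<open>w\<close> vanishes.\<close>

lemma psd_kernel:
  assumes "psd A" "x \<bullet> (A *v x) = 0"
  shows "A *v x = 0"
proof -
  define w where "w = A *v x"
  define c where "c = w \<bullet> (A *v w)"
  have sym: "symmetric_matrix A" and nonneg: "\<And>u. 0 \<le> u \<bullet> (A *v u)"
    using assms(1) by (auto simp: psd_def)
  have c: "0 \<le> c"
    unfolding c_def by (rule nonneg)
  \<comment> \<open>The exact minimiser would divide by \<open>c\<close>, which may be 0;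
    \<open>c + 1\<close> is safe and still makes the value negative unless \<open>w\<close> is
    0.\<close>
  define t where "t = - (w \<bullet> w) / (c + 1)"
  have "0 \<le> 2 * t * (w \<bullet> w) + t\<^sup>2 * c"
    using nonneg[of "x + t *\<^sub>R w"] symmetric_matrix_quadratic_add[OF sym, of x t w] assms(2)
    by (simp add: w_def c_def)
  also have "\<dots> = - (w \<bullet> w)\<^sup>2 * (c + 2) / (c + 1)\<^sup>2"
  proof -
    have "c + 1 \<noteq> 0"
      using c by simp
    then have "2 * (- W / (c + 1)) * W + (- W / (c + 1))\<^sup>2 * c = - W\<^sup>2 * (c + 2) / (c + 1)\<^sup>2" for W
      by (simp add: divide_simps power2_eq_square) (simp add: algebra_simps)
    then show ?thesis
      unfolding t_def .
  qed
  finally have "w \<bullet> w = 0"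
    using c by (simp add: divide_le_0_iff mult_le_0_iff)
  then show ?thesis
    by (simp add: w_def)
qed

section \<open>Traces of products, rank-one matrices, and the trace of a product of semidefinite
  matrices\<close>

lemma inner_axis_matrix_vector: "axis i 1 \<bullet> (A *v x) = (A *v x) $ i" for A :: "real^'n^'m"
  by (simp add: inner_axis')

lemma matrix_vector_axis_nth: "(A *v axis k 1) $ i = A $ i $ k" for A :: "real^'n^'m"
  by (simp add: matrix_vector_mul_component inner_axis)

lemma inner_matrix_vector_sum:
  "x \<bullet> (A *v y) = (\<Sum>i\<in>UNIV. \<Sum>j\<in>UNIV. A $ i $ j * (x $ i * y $ j))" for A :: "real^'n^'m"
  by (simp add: inner_vec_def matrix_vector_mult_def sum_distrib_left mult_ac)

lemma trace_mult_outer: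
  "trace (A ** (\<chi> i j. x $ i * y $ j)) = y \<bullet> (A *v x)" for A :: "real^'n^'n"
  by (simp add: trace_def matrix_matrix_mult_def inner_matrix_vector_sum mult_ac)

lemma inner_outer_vector:
  "u \<bullet> ((\<chi> i j. x $ i * x $ j) *v u) = (x \<bullet> u)\<^sup>2" for x u :: "real^'n"
  unfolding inner_matrix_vector_sum by (simp add: inner_vec_def power2_eq_square sum_product mult_ac)

lemma trace_mult_diff: "trace (A ** (B - C)) = trace (A ** B) - trace (A ** C)" for A :: "real^'n^'n"
  by (simp add: trace_def matrix_matrix_mult_def right_diff_distrib sum_subtractf)

lemma trace_mult_add_left: "trace ((A + B) ** C) = trace (A ** C) + trace (B ** C)" for A :: "real^'n^'n"
  by (simp add: trace_def matrix_matrix_mult_def distrib_right sum.distrib)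

lemma trace_mult_scaleR: "trace (A ** (c *\<^sub>R B)) = c * trace (A ** B)" for A :: "real^'n^'n"
  by (simp add: trace_def matrix_matrix_mult_def sum_distrib_left mult_ac)

lemma trace_mult_pencil:
  "trace (((\<Sum>i\<in>UNIV. y $ i *\<^sub>R H i) + Q) ** Y) = (\<Sum>i\<in>UNIV. y $ i * trace (H i ** Y)) + trace (Q ** Y)"
  for H :: "'n::finite \<Rightarrow> real^'n^'n"
proof -
  have "(\<Sum>i\<in>UNIV. y $ i *\<^sub>R H i) ** Y = (\<Sum>i\<in>UNIV. y $ i *\<^sub>R (H i ** Y))"
    by (simp add: vec_eq_iff matrix_matrix_mult_def sum_distrib_left sum_distrib_right mult_ac)
      (intro allI sum.swap)
  moreover have "trace (\<Sum>i\<in>UNIV. y $ i *\<^sub>R (H i ** Y)) = (\<Sum>i\<in>UNIV. y $ i * trace (H i ** Y))"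
    by (simp add: trace_def sum_distrib_left) (rule sum.swap)
  ultimately show ?thesis
    by (simp add: trace_mult_add_left)
qed

text \<open>Splitting off the rank-one part of the \<open>k\<close>-th column (a Schur complement) clears row \<open>k\<close>
  and creates no new nonzero diagonal entry.\<close>

lemma psd_trace_mult_nonneg:
  fixes A B :: "real^'n^'n"
  assumes "psd A" "psd B"
  shows "0 \<le> trace (A ** B)"
  using assms(2)
proof (induction "card {k. B $ k $ k \<noteq> 0}" arbitrary: B rule: less_induct)
  case less
  have sym: "symmetric_matrix B" and nonneg: "\<And>u. 0 \<le> u \<bullet> (B *v u)"
    using less.prems by (auto simp: psd_def)
  have diag: "axis k 1 \<bullet> (B *v axis k 1) = B $ k $ k" for k
    by (simp add: inner_axis_matrix_vector matrix_vector_axis_nth)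
  \<comment> \<open>A zero diagonal entry puts the \<open>k\<close>-th axis vector into the kernel,
    so the whole column vanishes. Hence a semidefinite matrix with zero diagonal is 0, the base
    case.\<close>
  have row0: "B $ i $ k = 0" if "B $ k $ k = 0" for i k
    using psd_kernel[OF less.prems, of "axis k 1"] that diag[of k]
    by (metis matrix_vector_axis_nth zero_index)
  show ?case
  proof (cases "\<exists>k. B $ k $ k \<noteq> 0")
    case False
    then have "B = 0"
      using row0 by (simp add: vec_eq_iff)
    then show ?thesis
      by (simp add: trace_def matrix_matrix_mult_def)
  next
    case True
    then obtain k where "B $ k $ k \<noteq> 0"
      by blast
    then have pos: "0 < B $ k $ k"
      using nonneg[of "axis k 1"] diag[of k] by simp
    define d where "d = B *v axis k 1"
    define E :: "real^'n^'n" where "E = (1 / B $ k $ k) *\<^sub>R (\<chi> i j. d $ i * d $ j)"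
    define C where "C = B - E"
    have d: "d $ i = B $ i $ k" for i
      by (simp add: d_def matrix_vector_axis_nth)
    have C_nth: "C $ i $ j = B $ i $ j - B $ i $ k * B $ j $ k / B $ k $ k" for i j
      by (simp add: C_def E_def d)
    have "symmetric_matrix C"
      using symmetric_matrix_nth[OF sym] by (intro symmetric_matrixI) (simp add: C_nth)
    moreover have "0 \<le> u \<bullet> (C *v u)" for u
    proof -
      \<comment> \<open>This \<open>t\<close> minimises the form of \<open>B\<close> along
        \<open>u + t *\<^sub>R axis k 1\<close>; the minimum is exactly the form of \<open>C\<close>
        at \<open>u\<close>.\<close>
      define t where "t = - (d \<bullet> u) / B $ k $ k"
      have "axis k 1 \<bullet> (B *v u) = d \<bullet> u"
        using symmetric_matrix_inner_commute[OF sym] by (simp add: d_def inner_commute)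
      then have "0 \<le> u \<bullet> (B *v u) + 2 * t * (d \<bullet> u) + t\<^sup>2 * B $ k $ k"
        using nonneg[of "u + t *\<^sub>R axis k 1"]
        unfolding symmetric_matrix_quadratic_add[OF sym] diag by simp
      also have "\<dots> = u \<bullet> (B *v u) - (d \<bullet> u)\<^sup>2 / B $ k $ k"
        using pos by (simp add: t_def field_simps power2_eq_square)
      also have "\<dots> = u \<bullet> (C *v u)"
        by (simp add: C_def E_def matrix_vector_mult_diff_rdistrib inner_diff_right
            scaleR_matrix_vector_assoc[symmetric] inner_outer_vector)
      finally show ?thesis .
    qed
    ultimately have psdC: "psd C"
      by (simp add: psd_def)
    have "C $ k $ k = 0"
      using pos by (simp add: C_nth)
    moreover have "C $ i $ i = 0" if "B $ i $ i = 0" for i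
      using that row0 symmetric_matrix_nth[OF sym] by (simp add: C_nth)
    ultimately have "{i. C $ i $ i \<noteq> 0} \<subset> {i. B $ i $ i \<noteq> 0}"
      using pos by force
    then have "0 \<le> trace (A ** C)"
      by (intro less.hyps psdC psubset_card_mono) auto
    moreover have "trace (A ** C) = trace (A ** B) - (d \<bullet> (A *v d)) / B $ k $ k"
      by (simp add: C_def E_def trace_mult_diff trace_mult_scaleR trace_mult_outer)
    \<comment> \<open>The split-off part \<open>E\<close> contributes precisely this quotient to the
      trace, so its sign follows from \<open>A\<close> alone.\<close>
    moreover have "0 \<le> (d \<bullet> (A *v d)) / B $ k $ k"
      using pos assms(1) by (simp add: psd_def)
    ultimately show ?thesis
      by linarith
  qed
qed

section \<open>Bordered matrices as quadratic forms in a vector and a scalar\<close>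

lemma sum_option:
  "(\<Sum>i\<in>UNIV. f i) = f None + (\<Sum>i\<in>UNIV. f (Some i))" for f :: "'n::finite option \<Rightarrow> real"
  by (simp add: UNIV_option_conv sum.reindex)

definition bordered_vector :: "real^'n \<Rightarrow> real \<Rightarrow> real^('n option)" where
  "bordered_vector u s = (\<chi> i. case i of Some k \<Rightarrow> u $ k | None \<Rightarrow> s)"

lemma bordered_vector_exhaust: obtains u s where "w = bordered_vector u s"
proof
  show "w = bordered_vector (\<chi> i. w $ Some i) (w $ None)"
    by (simp add: bordered_vector_def vec_eq_iff split: option.split)
qed

lemma bordered_matrix_mult_vector:
  "bordered_matrix A v c *v bordered_vector u s = bordered_vector (A *v u + s *\<^sub>R v) (v \<bullet> u + s * c)"
  by (simp add: vec_eq_iff bordered_matrix_def bordered_vector_def matrix_vector_mult_def sum_option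
      inner_vec_def split: option.split)

lemma inner_bordered_vector:
  "bordered_vector u s \<bullet> bordered_vector v t = u \<bullet> v + s * t"
  by (simp add: inner_vec_def sum_option bordered_vector_def)

lemma bordered_vector_eq_0_iff: "bordered_vector u s = 0 \<longleftrightarrow> u = 0 \<and> s = 0"
  by (auto simp: vec_eq_iff bordered_vector_def split: option.split)

lemma bordered_quadratic:
  "bordered_vector u s \<bullet> (bordered_matrix A v c *v bordered_vector u s)
    = u \<bullet> (A *v u) + 2 * s * (v \<bullet> u) + s\<^sup>2 * c"
  by (simp add: bordered_matrix_mult_vector inner_bordered_vector inner_add_right inner_commute
      algebra_simps power2_eq_square)

lemma symmetric_bordered_matrix: "symmetric_matrix (bordered_matrix A v c) \<longleftrightarrow> symmetric_matrix A"
  by (auto simp: symmetric_matrix_def transpose_def bordered_matrix_def vec_eq_iff split: option.split)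

text \<open>Every vector over the extended index type is a \<open>bordered_vector\<close>, so
  semidefiniteness becomes a scalar inequality in \<open>u\<close> and \<open>s\<close>; the lemmas
  below exploit it by choosing \<open>s\<close> or completing a square.\<close>

lemma psd_bordered_matrix_iff:
  "psd (bordered_matrix A v c) \<longleftrightarrow>
    symmetric_matrix A \<and> (\<forall>u s. 0 \<le> u \<bullet> (A *v u) + 2 * s * (v \<bullet> u) + s\<^sup>2 * c)"
  unfolding psd_def symmetric_bordered_matrix bordered_quadratic[symmetric]
  by (metis bordered_vector_exhaust)

lemma psd_bordered_matrix_block:
  assumes "psd (bordered_matrix A v c)"
  shows "psd A"
  \<comment> \<open>The instance \<open>s = 0\<close> leaves only the form of
    \<open>A\<close>.\<close>
  using assms[unfolded psd_bordered_matrix_iff] unfolding psd_def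
  by (metis add.right_neutral mult_zero_left mult_zero_right power_zero_numeral)

lemma psd_bordered_matrix_Schur:
  fixes y :: "real^'n"
  assumes "psd (bordered_matrix Y y 1)"
  shows "psd (Y - (\<chi> i j. y $ i * y $ j))"
  unfolding psd_def
proof (intro conjI allI)
  have sym: "symmetric_matrix Y"
    and nonneg: "\<And>u s. 0 \<le> u \<bullet> (Y *v u) + 2 * s * (y \<bullet> u) + s\<^sup>2 * 1"
    using assms by (auto simp: psd_bordered_matrix_iff)
  show "symmetric_matrix (Y - (\<chi> i j. y $ i * y $ j))"
    using symmetric_matrix_nth[OF sym] by (intro symmetric_matrixI) simp
  fix u
  show "0 \<le> u \<bullet> ((Y - (\<chi> i j. y $ i * y $ j)) *v u)"
    \<comment> \<open>This \<open>s\<close> minimises the bordered form for fixed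
      \<open>u\<close>.\<close>
    using nonneg[of u "- (y \<bullet> u)"]
    by (simp add: matrix_vector_mult_diff_rdistrib inner_diff_right inner_outer_vector power2_eq_square)
qed

text \<open>The bordered form at \<open>(u, s)\<close> is the form of \<open>M\<close> at
  \<open>u + s *\<^sub>R y\<close>.\<close>

lemma psd_bordered_matrix_image:
  assumes "psd M"
  shows "psd (bordered_matrix M (M *v y) (y \<bullet> (M *v y)))"
proof -
  have sym: "symmetric_matrix M"
    using assms by (simp add: psd_def)
  have "0 \<le> u \<bullet> (M *v u) + 2 * s * ((M *v y) \<bullet> u) + s\<^sup>2 * (y \<bullet> (M *v y))" for u s
    using assms symmetric_matrix_quadratic_add[OF sym, of u s y] symmetric_matrix_inner_commute[OF sym, of u y]
    unfolding psd_def by (metis inner_commute)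
  with sym show ?thesis
    by (simp add: psd_bordered_matrix_iff)
qed

lemma psd_bordered_matrix_outer: "psd (bordered_matrix (\<chi> i j. y $ i * y $ j) y 1)"
proof -
  \<comment> \<open>The bordered form is the square of \<open>y \<bullet> u + s\<close>.\<close>
  have "0 \<le> (y \<bullet> u)\<^sup>2 + 2 * s * (y \<bullet> u) + s\<^sup>2" for u and s :: real
    using zero_le_power2[of "y \<bullet> u + s"] by (simp add: power2_sum algebra_simps)
  then show ?thesis
    by (simp add: psd_bordered_matrix_iff inner_outer_vector symmetric_matrixI mult.commute)
qed

section \<open>Gradient and Hessian of the cubic\<close>

text \<open>\<open>gradient\<close> is a definite description, so uniqueness is needed: the
  derivative is unique as a linear functional, and a functional has only one representing
  vector.\<close>

lemma gradient_eqI: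
  assumes "GDERIV f x :> D"
  shows "gradient f x = D"
  unfolding gradient_def
proof (rule the_equality)
  fix E assume "GDERIV f x :> E"
  then have "(\<lambda>h. h \<bullet> E) = (\<lambda>h. h \<bullet> D)"
    using assms has_derivative_unique unfolding gderiv_def by blast
  then show "E = D"
    by (metis inner_commute vector_eq_ldot)
qed (fact assms)

lemma hessian_eqI:
  assumes "(gradient f has_derivative (*v) A) (at x)"
  shows "hessian f x = A"
  by (simp add: hessian_def jacobian_def frechet_derivative_at[OF assms, symmetric])

lemma sum_scaleR_axis: "(\<Sum>i\<in>UNIV. t i *\<^sub>R axis i 1) = (\<chi> i. t i)" for t :: "'n::finite \<Rightarrow> real"
  by (simp add: vec_eq_iff axis_def if_distrib[of "(*) _"] cong: if_cong)

lemma has_derivative_vec_lambda: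
  fixes f :: "'n::finite \<Rightarrow> 'a::real_normed_vector \<Rightarrow> real"
  assumes "\<And>i. (f i has_derivative f' i) F"
  shows "((\<lambda>x. \<chi> i. f i x) has_derivative (\<lambda>h. \<chi> i. f' i h)) F"
  unfolding sum_scaleR_axis[symmetric]
  by (intro has_derivative_sum has_derivative_scaleR_left assms)

lemma has_derivative_quadratic:
  assumes "symmetric_matrix A"
  shows "((\<lambda>x. x \<bullet> (A *v x)) has_derivative (\<lambda>h. 2 * (h \<bullet> (A *v x)))) (at x)"
proof -
  have "((*v) A has_derivative (*v) A) (at x)"
    by (intro bounded_linear_imp_has_derivative matrix_vector_mul_bounded_linear)
  from has_derivative_inner[OF has_derivative_ident this] show ?thesis
    using symmetric_matrix_inner_commute[OF assms, of x] by simp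
qed

lemma matrix_vector_mult_sum_left: "(\<Sum>i\<in>I. A i) *v x = (\<Sum>i\<in>I. A i *v x)" for A :: "'i \<Rightarrow> real^'n^'m"
  by (induction I rule: infinite_finite_induct) (simp_all add: matrix_vector_mult_add_rdistrib)

text \<open>The family \<open>H\<close> is a three-index tensor. Exchange symmetry lets the free row
  index \<open>i\<close> trade places with the summed family index, turning a combination of
  matrices into a single form of \<open>H i\<close>.\<close>

lemma pencil_vector_nth:
  fixes H :: "'n::finite \<Rightarrow> real^'n^'n"
  assumes "\<And>i j k. H i $ j $ k = H j $ i $ k"
  shows "((\<Sum>i\<in>UNIV. x $ i *\<^sub>R H i) *v h) $ i = x \<bullet> (H i *v h)"
proof -
  have "((\<Sum>i\<in>UNIV. x $ i *\<^sub>R H i) *v h) $ i = (\<Sum>k\<in>UNIV. \<Sum>j\<in>UNIV. x $ j * H j $ i $ k * h $ k)"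
    by (simp add: matrix_vector_mult_def sum_distrib_right)
  also have "\<dots> = (\<Sum>j\<in>UNIV. \<Sum>k\<in>UNIV. H i $ j $ k * (x $ j * h $ k))"
    by (subst sum.swap) (simp add: assms[of i] mult_ac)
  finally show ?thesis
    by (simp add: inner_matrix_vector_sum)
qed

context
  fixes p :: "real^'n \<Rightarrow> real" and H :: "'n \<Rightarrow> real^'n^'n" and Q :: "real^'n^'n" and b :: "real^'n"
  assumes H_sym: "\<And>i. symmetric_matrix (H i)"
    and Q_sym: "symmetric_matrix Q"
    and H_swap: "\<And>i j k. H i $ j $ k = H j $ i $ k"
    and p_form: "\<And>x. p x = 1/6 * (\<Sum>i\<in>UNIV. x \<bullet> (((x $ i) *\<^sub>R H i) *v x))
                            + 1/2 * (x \<bullet> (Q *v x)) + b \<bullet> x"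
begin

text \<open>The product rule on the cubic part yields the same contraction of the tensor with
  \<open>h\<close>, \<open>x\<close>, \<open>x\<close> three times, so the factor 1/6 becomes
  1/2.\<close>

lemma cubic_gradient:
  "gradient p x = (\<chi> i. 1/2 * (x \<bullet> (H i *v x))) + Q *v x + b" (is "_ = ?g")
proof (rule gradient_eqI)
  have p: "p = (\<lambda>x. 1/6 * (\<Sum>i\<in>UNIV. x $ i * (x \<bullet> (H i *v x))) + 1/2 * (x \<bullet> (Q *v x)) + b \<bullet> x)"
    by (rule ext) (simp add: p_form scaleR_matrix_vector_assoc[symmetric])
  have "(\<Sum>i\<in>UNIV. x $ i * (h \<bullet> (H i *v x))) = (\<Sum>i\<in>UNIV. h $ i * (x \<bullet> (H i *v x)))" for h
  proof -
    have "(\<Sum>i\<in>UNIV. x $ i * (h \<bullet> (H i *v x))) = h \<bullet> ((\<Sum>i\<in>UNIV. x $ i *\<^sub>R H i) *v x)"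
      by (simp add: matrix_vector_mult_sum_left inner_sum_right scaleR_matrix_vector_assoc[symmetric])
    also have "\<dots> = (\<Sum>i\<in>UNIV. h $ i * (x \<bullet> (H i *v x)))"
      by (simp add: inner_vec_def[of h] pencil_vector_nth[OF H_swap])
    finally show ?thesis .
  qed
  \<comment> \<open>The right-hand side is spelled out in the shape that the derivative rules
    produce, so that they apply literally below.\<close>
  then have grad: "h \<bullet> ?g = 1/6 * (\<Sum>i\<in>UNIV. x $ i * (2 * (h \<bullet> (H i *v x))) + h $ i * (x \<bullet> (H i *v x)))
      + 1/2 * (2 * (h \<bullet> (Q *v x))) + b \<bullet> h" for h
    by (simp add: inner_add_right inner_vec_def[of h "\<chi> i. _ i"] sum.distrib sum_distrib_left[symmetric]
        sum_divide_distrib[symmetric] inner_commute[of b] mult.left_commute[of _ 2])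
  have "((\<lambda>x. x $ i * (x \<bullet> (H i *v x))) has_derivative
      (\<lambda>h. x $ i * (2 * (h \<bullet> (H i *v x))) + h $ i * (x \<bullet> (H i *v x)))) (at x)" for i
    by (intro has_derivative_mult has_derivative_quadratic H_sym
        bounded_linear_imp_has_derivative bounded_linear_vec_nth)
  then show "GDERIV p x :> ?g"
    unfolding gderiv_def p grad
    by (intro has_derivative_add has_derivative_mult_right has_derivative_sum has_derivative_quadratic
        has_derivative_inner_right has_derivative_ident Q_sym)
qed

text \<open>Differentiating component \<open>i\<close> of the gradient gives
  \<open>x \<bullet> (H i *v h)\<close> from the cubic part; \<open>pencil_vector_nth\<close>
  reassembles these components into one matrix acting on \<open>h\<close>.\<close>

lemma cubic_hessian: "hessian p x = (\<Sum>i\<in>UNIV. x $ i *\<^sub>R H i) + Q"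
proof (rule hessian_eqI)
  have half: "1/2 * (2 * (h \<bullet> (H i *v x))) = x \<bullet> (H i *v h)" for h i
    using symmetric_matrix_inner_commute[OF H_sym, of x i h] by simp
  have "((\<lambda>x. 1/2 * (x \<bullet> (H i *v x))) has_derivative (\<lambda>h. x \<bullet> (H i *v h))) (at x)" for i
    unfolding half[symmetric] by (intro has_derivative_mult_right has_derivative_quadratic H_sym)
  then have "((\<lambda>x. (\<chi> i. 1/2 * (x \<bullet> (H i *v x))) + Q *v x + b) has_derivative
      (\<lambda>h. (\<chi> i. x \<bullet> (H i *v h)) + Q *v h)) (at x)"
    by (intro has_derivative_add_const has_derivative_add has_derivative_vec_lambda
        bounded_linear_imp_has_derivative matrix_vector_mul_bounded_linear)
  moreover have "(\<chi> i. x \<bullet> (H i *v h)) + Q *v h = ((\<Sum>i\<in>UNIV. x $ i *\<^sub>R H i) + Q) *v h" for h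
    by (simp add: vec_eq_iff matrix_vector_mult_add_rdistrib pencil_vector_nth[OF H_swap])
  ultimately show "(gradient p has_derivative (*v) ((\<Sum>i\<in>UNIV. x $ i *\<^sub>R H i) + Q)) (at x)"
    by (simp only: cubic_gradient[abs_def])
qed

end

section \<open>Second-order points and feasible triples\<close>

theorem corollary6p5:
  fixes p :: "real^'n \<Rightarrow> real"
    and H :: "'n \<Rightarrow> real^'n^'n"
    and Q :: "real^'n^'n"
    and b :: "real^'n"
  assumes H_sym: "\<And>i. symmetric_matrix (H i)"
    and Q_sym: "symmetric_matrix Q"
    and H_perm: "\<And>i j k. H i $ j $ k = H j $ i $ k \<and> H j $ i $ k = H k $ i $ j"
    and p_form: "\<And>x. p x = 1/6 * (\<Sum>i\<in>UNIV. x \<bullet> (((x $ i) *\<^sub>R H i) *v x))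
                            + 1/2 * (x \<bullet> (Q *v x)) + b \<bullet> x"
  shows "{x. second_order_point p x} =
    {y. \<exists>(Y :: real^'n^'n) (z :: real).
        symmetric_matrix Y \<and>
        1/2 * trace (Q ** Y) + b \<bullet> y + z / 2 = 0 \<and>
        (\<forall>i. 1/2 * trace (H i ** Y) + axis i 1 \<bullet> (Q *v y) + b $ i = 0) \<and>
        psd (T_matrix H Q Y y z) \<and>
        psd (bordered_matrix Y y 1)}"
proof -
  have H_swap: "H i $ j $ k = H j $ i $ k" for i j k
    using H_perm by blast
  define M where "M y = (\<Sum>i\<in>UNIV. y $ i *\<^sub>R H i) + Q" for y
  have M_vec: "M y *v y = (\<chi> i. y \<bullet> (H i *v y)) + Q *v y" for y
    by (simp add: M_def vec_eq_iff matrix_vector_mult_add_rdistrib pencil_vector_nth[OF H_swap])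
  have sop: "second_order_point p y \<longleftrightarrow>
      (\<forall>i. 1/2 * (y \<bullet> (H i *v y)) + (Q *v y) $ i + b $ i = 0) \<and> psd (M y)" for y
    unfolding second_order_point_def cubic_gradient[OF H_sym Q_sym H_swap p_form]
      cubic_hessian[OF H_sym Q_sym H_swap p_form]
    by (simp add: vec_eq_iff M_def)
  have T: "T_matrix H Q Y y z = bordered_matrix (M y) ((\<chi> i. trace (H i ** Y)) + Q *v y) z" for Y y z
    by (simp add: T_matrix_def M_def sum_scaleR_axis)
  \<comment> \<open>Weight equation \<open>i\<close> by \<open>y $ i\<close> and sum. This serves
    both directions: \<open>t i\<close> is \<open>y \<bullet> (H i *v y)\<close> in the first and
    \<open>trace (H i ** Y)\<close> in the second.\<close>
  have stationary_sum: "1/2 * (\<Sum>i\<in>UNIV. y $ i * t i) + y \<bullet> (Q *v y) + b \<bullet> y = 0"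
    if "\<And>i. 1/2 * t i + (Q *v y) $ i + b $ i = 0" for t y
  proof -
    have "(\<Sum>i\<in>UNIV. y $ i * (1/2 * t i + (Q *v y) $ i + b $ i)) = 0"
      by (simp only: that) simp
    then show ?thesis
      by (simp add: inner_vec_def algebra_simps sum.distrib sum_distrib_left)
  qed
  show ?thesis
  proof (intro set_eqI iffI; clarsimp simp only: mem_Collect_eq)
    fix y assume y: "second_order_point p y"
    define Y :: "real^'n^'n" where "Y = (\<chi> i j. y $ i * y $ j)"
    have trY: "trace (A ** Y) = y \<bullet> (A *v y)" for A
      by (simp add: Y_def trace_mult_outer)
    define z where "z = y \<bullet> (M y *v y)"
    have grad: "\<And>i. 1/2 * (y \<bullet> (H i *v y)) + (Q *v y) $ i + b $ i = 0" and "psd (M y)"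
      using y by (auto simp: sop)
    have z: "z = (\<Sum>i\<in>UNIV. y $ i * (y \<bullet> (H i *v y))) + y \<bullet> (Q *v y)"
      by (simp add: z_def M_vec inner_add_right) (simp add: inner_vec_def)
    \<comment> \<open>For rank-one \<open>Y\<close> the border of T is \<open>M y *v y\<close>, and
      \<open>z\<close> was chosen as the matching corner, so T has the form treated in
      \<open>psd_bordered_matrix_image\<close>.\<close>
    have "T_matrix H Q Y y z = bordered_matrix (M y) (M y *v y) z"
      by (simp add: T M_vec trY)
    then have "psd (T_matrix H Q Y y z)"
      using psd_bordered_matrix_image[OF \<open>psd (M y)\<close>] by (simp add: z_def)
    moreover have "1/2 * trace (Q ** Y) + b \<bullet> y + z / 2 = 0"
      using stationary_sum[OF grad] by (simp add: trY z field_simps)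
    moreover have "psd (bordered_matrix Y y 1)"
      by (simp add: Y_def psd_bordered_matrix_outer)
    moreover have "symmetric_matrix Y"
      by (simp add: Y_def symmetric_matrixI mult.commute)
    ultimately show "\<exists>Y z. symmetric_matrix Y \<and>
        1/2 * trace (Q ** Y) + b \<bullet> y + z / 2 = 0 \<and>
        (\<forall>i. 1/2 * trace (H i ** Y) + axis i 1 \<bullet> (Q *v y) + b $ i = 0) \<and>
        psd (T_matrix H Q Y y z) \<and> psd (bordered_matrix Y y 1)"
      using grad by (intro exI[of _ Y] exI[of _ z]) (simp add: trY inner_axis_matrix_vector)
  next
    fix y Y z
    assume obj: "1/2 * trace (Q ** Y) + b \<bullet> y + z / 2 = 0"
      and lin: "\<forall>i. 1/2 * trace (H i ** Y) + axis i 1 \<bullet> (Q *v y) + b $ i = 0"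
      and psdT: "psd (T_matrix H Q Y y z)" and psdY: "psd (bordered_matrix Y y 1)"
    define t where "t i = trace (H i ** Y)" for i
    define v where "v = (\<chi> i. t i) + Q *v y"
    define D where "D = Y - (\<chi> i j. y $ i * y $ j)"
    define w where "w = bordered_vector y (- 1)"
    have grad: "1/2 * t i + (Q *v y) $ i + b $ i = 0" for i
      using lin by (simp add: t_def inner_axis_matrix_vector)
    have psdB: "psd (bordered_matrix (M y) v z)"
      using psdT by (simp add: T v_def t_def)
    then have psdM: "psd (M y)"
      by (rule psd_bordered_matrix_block)
    have "v \<bullet> y = (\<Sum>i\<in>UNIV. y $ i * t i) + y \<bullet> (Q *v y)"
      unfolding v_def inner_commute[of _ y] inner_add_right by (simp add: inner_vec_def)
    moreover have "trace (M y ** D) = (\<Sum>i\<in>UNIV. y $ i * t i) + trace (Q ** Y) - y \<bullet> (M y *v y)"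
      unfolding D_def trace_mult_diff trace_mult_outer
      by (simp add: M_def trace_mult_pencil t_def)
    moreover have "w \<bullet> (bordered_matrix (M y) v z *v w) = y \<bullet> (M y *v y) - 2 * (v \<bullet> y) + z"
      by (simp add: w_def bordered_quadratic)
    \<comment> \<open>The terms \<open>y \<bullet> (M y *v y)\<close> cancel, leaving
      \<open>trace (Q ** Y) + z\<close> minus the sum of the \<open>y $ i * t i\<close> minus
      \<open>2 * (y \<bullet> (Q *v y))\<close>. By \<open>obj\<close> the first two terms equal
      \<open>- 2 * (b \<bullet> y)\<close>, and by \<open>stationary_sum\<close> so does what is
      subtracted.\<close>
    ultimately have "trace (M y ** D) + w \<bullet> (bordered_matrix (M y) v z *v w) = 0"
      using obj stationary_sum[OF grad] by simp
    moreover have "0 \<le> trace (M y ** D)"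
      unfolding D_def by (intro psd_trace_mult_nonneg psdM psd_bordered_matrix_Schur psdY)
    moreover have "0 \<le> w \<bullet> (bordered_matrix (M y) v z *v w)"
      using psdB by (simp add: psd_def)
    ultimately have "bordered_matrix (M y) v z *v w = 0"
      by (intro psd_kernel[OF psdB]) simp
    \<comment> \<open>Only the top block of the kernel equation is used; the common summand
      \<open>Q *v y\<close> then cancels.\<close>
    then have "M y *v y = v"
      by (simp add: w_def bordered_matrix_mult_vector bordered_vector_eq_0_iff)
    then have "y \<bullet> (H i *v y) = t i" for i
      by (simp add: M_vec v_def vec_eq_iff)
    then show "second_order_point p y"
      using grad psdM by (simp add: sop)
  qed
qed

end
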